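(* Let $I=(0,\rho)$ with $0<\rho\le\infty$, let $\Omega\subseteq\mathbb{C}$ satisfy $\Omega\cap(0,\infty)=I$, and let $f:\Omega\to\mathbb{C}$ be a map. Fix an integer $N\ge2$, and suppose that $f_\diamond(A)_h\in\mathbb{P}_N$ for all $A=(a_{ij})\in\mathbb{P}_N(\Omega)$ and for all $h>0$ such that $(a_{00},a_{00}+2(N-1)h)\subseteq I$. Then $f$ maps $I$ into $\mathbb{R}$, and $f:I\to\mathbb{R}$ is nonnegative, nondecreasing, and continuous. Moreover, when $N\ge3$ and $\rho=\infty$, $f:I\to\mathbb{R}$ is convex.
   Context: Matrices in $\mathbb{C}^{N\times N}$ are indexed by $(i,j)\in\mathcal{K}_{N,N}:=\{0,\dots,N-1\}^2$; put $\mathcal{K}^*_{N,N}:=\mathcal{K}_{N,N}\setminus\{(0,0)\}$. A matrix $A$ with $A^*=A$ is positive semidefinite if $z^*Az\ge 0$ for all $z\in\mathbb{C}^N$. $\mathbb{P}_N(\Omega)$ is the set of $N\times N$ positive semidefinite matrices with entries in $\Omega$, and $\mathbb{P}_N:=\mathbb{P}_N(\mathbb{C})$. For $\ell\ge1$ and $(i,j)\in\mathcal{K}^*_{N,N}$, $\mathcal{P}^*_\ell(i,j)$ is the set of all multisets $S$ of $\ell$ elements (counted with multiplicity) of $\mathcal{K}^*_{N,N}$ with $\sum_{(p,q)\in S}(p,q)=(i,j)$; $c_S(m,n)$ is the multiplicity of $(m,n)$ in $S$. For $h>0$ and $\ell\ge0$, $(D_h^\ell f)(x):=h^{-\ell}\sum_{k=0}^\ell\binom{\ell}{k}(-1)^{\ell-k}f(x+kh)$,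 defined whenever $x,x+h,\dots,x+\ell h$ lie in the domain of $f$. For $A=(a_{ij})\in\Omega^{N\times N}$ and $h>0$ such that $a_{00}+kh\in\Omega$ for $k=0,1,\dots,2N-2$, the matrix $f_\diamond(A)_h\in\mathbb{C}^{N\times N}$ is defined by $(f_\diamond(A)_h)_{00}:=f(a_{00})$ and, for $(i,j)\in\mathcal{K}^*_{N,N}$, $$(f_\diamond(A)_h)_{ij}:=\sum_{\ell=1}^{i+j}(D_h^\ell f)(a_{00})\sum_{S\in\mathcal{P}^*_\ell(i,j)}\frac{1}{\prod_{(m,n)\in\mathcal{K}^*_{N,N}}c_S(m,n)!}\prod_{(p,q)\in S}a_{p,q},$$ products over $S$ being taken with multiplicity. The hypothesis concerns only those $h$ for which $f_\diamond(A)_h$ is defined in this sense. *)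

theory Defs
  imports
    "HOL-Analysis.Convex"
    "HOL-Library.Extended_Real"
    "HOL-Library.Multiset"
    "HOL-Library.Product_Plus"
    "Jordan_Normal_Form.Schur_Decomposition"
begin

(* The complex order of Complex_Order makes "0 \<le> w" say that w is real and nonnegative;
   (A *\<^sub>v z) \<bullet>c z is the sesquilinear form z^* A z. *)
definition pos_semidef :: "nat \<Rightarrow> complex mat \<Rightarrow> bool" where
  "pos_semidef N A \<longleftrightarrow> A \<in> carrier_mat N N \<and> mat_adjoint A = A \<and>
     (\<forall>z \<in> carrier_vec N. 0 \<le> (A *\<^sub>v z) \<bullet>c z)"

definition psd_mats :: "nat \<Rightarrow> complex set \<Rightarrow> complex mat set" where
  "psd_mats N \<Omega> = {A. pos_semidef N A \<and> (\<forall>i<N. \<forall>j<N. A $$ (i, j) \<in> \<Omega>)}"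

definition Kstar :: "nat \<Rightarrow> (nat \<times> nat) set" where
  "Kstar N = ({0..<N} \<times> {0..<N}) - {(0, 0)}"

(* The sum of the multiset is taken componentwise in nat \<times> nat. *)
definition Pstar :: "nat \<Rightarrow> nat \<Rightarrow> nat \<times> nat \<Rightarrow> (nat \<times> nat) multiset set" where
  "Pstar N l ij = {S. set_mset S \<subseteq> Kstar N \<and> size S = l \<and> sum_mset S = ij}"

(* Finiteness matters because Pstar is the range of a sum. *)
lemma finite_Pstar: "finite (Pstar N l ij)"
proof -
  have "finite {xs. set xs \<subseteq> Kstar N \<and> length xs = l}"
    by (rule finite_lists_length_eq) (simp add: Kstar_def)
  moreover have "Pstar N l ij \<subseteq> mset ` {xs. set xs \<subseteq> Kstar N \<and> length xs = l}"
  proof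
    fix S assume S: "S \<in> Pstar N l ij"
    obtain xs where "mset xs = S" using ex_mset by blast
    with S show "S \<in> mset ` {xs. set xs \<subseteq> Kstar N \<and> length xs = l}"
      by (auto simp: Pstar_def)
  qed
  ultimately show ?thesis by (rule finite_surj)
qed

(* A map with domain \<Omega> is represented by a total function. Dh h l f x depends only on the
   values of f at x, x + h, ..., x + l h and is to be used only when these lie in \<Omega>. *)
definition Dh :: "real \<Rightarrow> nat \<Rightarrow> (complex \<Rightarrow> complex) \<Rightarrow> complex \<Rightarrow> complex" where
  "Dh h l f x = inverse (of_real h ^ l) *
     (\<Sum>k = 0..l. of_nat (l choose k) * (- 1) ^ (l - k) * f (x + of_nat k * of_real h))"

definition f_diamond :: "(complex \<Rightarrow> complex) \<Rightarrow> nat \<Rightarrow> real \<Rightarrow> complex mat \<Rightarrow> complex mat" where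
  "f_diamond f N h A = mat N N (\<lambda>(i, j).
     if (i, j) = (0, 0) then f (A $$ (0, 0))
     else (\<Sum>l = 1..i + j. Dh h l f (A $$ (0, 0)) *
            (\<Sum>S \<in> Pstar N l (i, j).
               1 / (\<Prod>mn \<in> Kstar N. fact (count S mn)) * (\<Prod>pq \<in># S. A $$ pq))))"

(* The arguments of f that enter f_diamond f N h A all lie in \<Omega>. *)
definition f_diamond_defined :: "complex set \<Rightarrow> nat \<Rightarrow> real \<Rightarrow> complex mat \<Rightarrow> bool" where
  "f_diamond_defined \<Omega> N h A \<longleftrightarrow>
     (\<forall>k \<in> {0..2 * N - 2}. A $$ (0, 0) + of_nat k * of_real h \<in> \<Omega>)"

end

theory Submission
  imports Defs
begin

text \<open>
  The hypothesis is tested on the matrices of the form \<open>e J + diag d\<close> with \<open>J\<close> the all-ones matrix,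
  whose entries can be kept in \<open>I\<close> (the domain need not contain \<open>0\<close>) while \<open>e\<close> tends to \<open>0\<close>.
  Write \<open>D\<^sup>k\<close> for the difference quotients of \<open>f\<close> at the \<open>(0, 0)\<close> entry \<open>a\<close>.
  When every other entry is \<open>t\<close>, the \<open>(1, 1)\<close> entry of the image is \<open>t D\<^sup>1 + t\<^sup>2 D\<^sup>2\<close>,
  and \<open>t \<rightarrow> 0\<close> gives \<open>D\<^sup>1 \<ge> 0\<close>. When every entry is \<open>a\<close>, the leading 2 by 2 minor gives
  \<open>(D\<^sup>1)\<^sup>2 \<le> f(a) (D\<^sup>1 / a + D\<^sup>2)\<close>; multiplied by \<open>h\<^sup>2\<close>, this turns a jump of size \<open>\<delta>\<close> of
  the monotone function \<open>f\<close> into \<open>\<delta>\<^sup>2 \<le> - c \<delta>\<close> with \<open>c \<ge> 0\<close> as \<open>h \<rightarrow> 0\<close>, so there is none.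
  When \<open>A\<close> tends to \<open>diag (a, T, T, \<dots>)\<close>, the \<open>(2, 2)\<close> entry tends to \<open>T D\<^sup>1 + (T\<^sup>2/2) D\<^sup>2\<close>, so
  that \<open>T \<rightarrow> \<infinity>\<close> gives \<open>D\<^sup>2 \<ge> 0\<close>, i.e. midpoint convexity.
\<close>

section \<open>Positivity of principal forms and of 2 by 2 minors\<close>

lemma mat_adjoint_eq_mat:
  fixes A :: "complex mat"
  assumes "A \<in> carrier_mat n n"
  shows "mat_adjoint A = mat n n (\<lambda>(i, j). cnj (A $$ (j, i)))"
  using assms by (auto simp: mat_adjoint_def mat_of_rows_def intro!: eq_matI)

lemma sesquilinear_form_eq_sum:
  fixes A :: "complex mat"
  assumes "A \<in> carrier_mat N N" "z \<in> carrier_vec N"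
  shows "(A *\<^sub>v z) \<bullet>c z = (\<Sum>i<N. (\<Sum>j<N. A $$ (i, j) * z $ j) * cnj (z $ i))"
  using assms by (auto simp: scalar_prod_def lessThan_atLeast0 intro!: sum.cong)

text \<open>Extending \<open>c\<close> by zero outside \<open>K\<close> gives a vector of length
  \<open>N\<close>, and only the terms with both indices in \<open>K\<close> survive in its form.
  Positivity thus passes to principal submatrices.\<close>

lemma pos_semidefD_supported:
  assumes "pos_semidef N A" "K \<subseteq> {..<N}"
  shows "0 \<le> (\<Sum>i\<in>K. (\<Sum>j\<in>K. A $$ (i, j) * c j) * cnj (c i))"
proof -
  define z where "z = vec N (\<lambda>i. if i \<in> K then c i else 0)"
  have A: "A \<in> carrier_mat N N" and z: "z \<in> carrier_vec N"
    using assms by (auto simp: pos_semidef_def z_def)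
  have "0 \<le> (A *\<^sub>v z) \<bullet>c z"
    using assms z by (auto simp: pos_semidef_def)
  also have "\<dots> = (\<Sum>i<N. (\<Sum>j<N. A $$ (i, j) * z $ j) * cnj (z $ i))"
    by (rule sesquilinear_form_eq_sum[OF A z])
  also have "\<dots> = (\<Sum>i\<in>K. (\<Sum>j<N. A $$ (i, j) * z $ j) * cnj (z $ i))"
    using assms(2) by (intro sum.mono_neutral_right) (auto simp: z_def)
  also have "\<dots> = (\<Sum>i\<in>K. (\<Sum>j\<in>K. A $$ (i, j) * z $ j) * cnj (z $ i))"
    using assms(2) by (intro sum.cong arg_cong2[where f = "(*)"] sum.mono_neutral_right refl)
      (auto simp: z_def)
  also have "\<dots> = (\<Sum>i\<in>K. (\<Sum>j\<in>K. A $$ (i, j) * c j) * cnj (c i))"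
    using assms(2) by (intro sum.cong arg_cong2[where f = "(*)"] refl) (auto simp: z_def)
  finally show ?thesis .
qed

lemma pos_semidef_diag_nonneg:
  assumes "pos_semidef N A" "i < N"
  shows "0 \<le> A $$ (i, i)"
  using pos_semidefD_supported[OF assms(1), of "{i}" "\<lambda>_. 1"] assms(2) by simp

lemma nonneg_quadratic_form_discriminant:
  fixes p q r :: real
  assumes "\<And>x y. 0 \<le> p * x\<^sup>2 + 2 * q * x * y + r * y\<^sup>2"
  shows "q\<^sup>2 \<le> p * r"
proof (cases "p = 0")
  case False
  have "0 \<le> p" using assms[of 1 0] by simp
  moreover have "0 \<le> p * (p * r - q\<^sup>2)"
    \<comment> \<open>At \<open>(- q, p)\<close> the form equals
      \<open>p * (p * r - q^2)\<close>.\<close>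
    using assms[of "- q" p] by (simp add: power2_eq_square algebra_simps)
  ultimately show ?thesis using False by (simp add: zero_le_mult_iff)
next
  case True
  have "q = 0"
  proof (rule ccontr)
    assume "q \<noteq> 0"
    \<comment> \<open>With \<open>p = 0\<close> the form is linear in \<open>x\<close> at
      \<open>y = 1\<close>; this \<open>x\<close> gives it the value -1.\<close>
    then show False using assms[of "- (r + 1) / (2 * q)" 1] True by simp
  qed
  then show ?thesis using True by simp
qed

lemma pos_semidef_real_minor:
  assumes "pos_semidef N A" "i < N" "j < N" "i \<noteq> j"
    and "A $$ (i, i) = of_real p" "A $$ (i, j) = of_real q"
    and "A $$ (j, i) = of_real q" "A $$ (j, j) = of_real r"
  shows "q\<^sup>2 \<le> p * r"
proof (rule nonneg_quadratic_form_discriminant)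
  fix x y :: real
  let ?c = "\<lambda>k. complex_of_real (if k = i then x else y)"
  have "0 \<le> (\<Sum>k\<in>{i, j}. (\<Sum>l\<in>{i, j}. A $$ (k, l) * ?c l) * cnj (?c k))"
    using assms(1-3) by (intro pos_semidefD_supported) auto
  also have "\<dots> = complex_of_real (p * x\<^sup>2 + 2 * q * x * y + r * y\<^sup>2)"
    using assms(4-) by (simp add: power2_eq_square algebra_simps)
  finally show "0 \<le> p * x\<^sup>2 + 2 * q * x * y + r * y\<^sup>2"
    by (simp add: less_eq_complex_def)
qed

section \<open>The test matrices\<close>

definition const_plus_diag :: "nat \<Rightarrow> real \<Rightarrow> (nat \<Rightarrow> real) \<Rightarrow> complex mat" where
  "const_plus_diag N e d = mat N N (\<lambda>(i, j). of_real (e + (if i = j then d i else 0)))"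

lemma const_plus_diag_index:
  "i < N \<Longrightarrow> j < N \<Longrightarrow>
    const_plus_diag N e d $$ (i, j) = of_real (e + (if i = j then d i else 0))"
  by (simp add: const_plus_diag_def)

text \<open>The form splits as \<open>e\<close> times the squared modulus of the coordinate sum,
  plus the sum of \<open>d i\<close> times the squared moduli of the coordinates.\<close>

lemma pos_semidef_const_plus_diag:
  assumes "0 \<le> e" "\<And>i. i < N \<Longrightarrow> 0 \<le> d i"
  shows "pos_semidef N (const_plus_diag N e d)"
  unfolding pos_semidef_def
proof (intro conjI ballI)
  let ?A = "const_plus_diag N e d"
  show A: "?A \<in> carrier_mat N N" by (simp add: const_plus_diag_def)
  show "mat_adjoint ?A = ?A"
    by (subst mat_adjoint_eq_mat[OF A]) (auto simp: const_plus_diag_def intro!: eq_matI)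
  fix z :: "complex vec" assume z: "z \<in> carrier_vec N"
  have row: "(\<Sum>j<N. ?A $$ (i, j) * z $ j) = of_real e * (\<Sum>j<N. z $ j) + of_real (d i) * z $ i"
    if "i < N" for i
  proof -
    have "(\<Sum>j<N. ?A $$ (i, j) * z $ j)
        = (\<Sum>j<N. of_real e * z $ j + (if i = j then of_real (d i) * z $ j else 0))"
      using that by (intro sum.cong) (auto simp: const_plus_diag_index algebra_simps)
    also have "\<dots> = of_real e * (\<Sum>j<N. z $ j) + of_real (d i) * z $ i"
      using that by (simp add: sum.distrib sum_distrib_left)
    finally show ?thesis .
  qed
  have "(?A *\<^sub>v z) \<bullet>c z = (\<Sum>i<N. (of_real e * (\<Sum>j<N. z $ j) + of_real (d i) * z $ i) * cnj (z $ i))"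
    by (simp add: sesquilinear_form_eq_sum[OF A z] row)
  also have "\<dots> = of_real e * ((\<Sum>j<N. z $ j) * cnj (\<Sum>j<N. z $ j))
      + (\<Sum>i<N. of_real (d i) * (z $ i * cnj (z $ i)))"
    by (simp only: distrib_right sum.distrib cnj_sum mult.assoc sum_distrib_left[symmetric])
  also have "\<dots> = of_real (e * (cmod (\<Sum>j<N. z $ j))\<^sup>2 + (\<Sum>i<N. d i * (cmod (z $ i))\<^sup>2))"
    by (simp only: complex_norm_square[symmetric] of_real_add of_real_mult of_real_sum)
  also have "0 \<le> \<dots>"
  proof -
    have "0 \<le> e * (cmod (\<Sum>j<N. z $ j))\<^sup>2 + (\<Sum>i<N. d i * (cmod (z $ i))\<^sup>2)"
      using assms by (intro add_nonneg_nonneg sum_nonneg mult_nonneg_nonneg) auto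
    then show ?thesis
      by (simp only: less_eq_complex_def Re_complex_of_real Im_complex_of_real zero_complex.simps
          simp_thms)
  qed
  finally show "0 \<le> (?A *\<^sub>v z) \<bullet>c z" .
qed

section \<open>The multisets and image entries at \<open>(0, 0)\<close>, \<open>(0, 1)\<close>,
  \<open>(1, 0)\<close>, \<open>(1, 1)\<close> and \<open>(2, 2)\<close>\<close>

lemma Pstar_1:
  assumes "ij \<in> Kstar N"
  shows "Pstar N 1 ij = {{#ij#}}"
  using assms by (auto simp: Pstar_def dest!: size_1_singleton_mset[unfolded One_nat_def])

lemma size_eq_2_imp_eq_pair_mset:
  assumes "size S = 2"
  obtains a b where "S = {#a, b#}"
proof -
  have "size S = Suc 1" using assms by simp
  then obtain a T where "S = add_mset a T" "size T = 1"
    by (metis size_eq_Suc_imp_eq_union size_add_mset diff_Suc_1 nat.inject)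
  then show ?thesis using that by (metis One_nat_def size_1_singleton_mset)
qed

text \<open>The other splitting, \<open>(1, 1) + (0, 0)\<close>, is ruled out because
  \<open>Kstar\<close> omits the origin.\<close>

lemma Pstar_2_11:
  assumes "2 \<le> N"
  shows "Pstar N 2 (1, 1) = {{#(0, 1), (1, 0)#}}"
proof (intro equalityI subsetI)
  fix S assume S: "S \<in> Pstar N 2 (1, 1)"
  then have "size S = 2" by (simp add: Pstar_def)
  then obtain a b where ab: "S = {#a, b#}"
    by (rule size_eq_2_imp_eq_pair_mset)
  obtain a1 a2 b1 b2 where "a = (a1, a2)" "b = (b1, b2)" by (metis surj_pair)
  with S ab show "S \<in> {{#(0, 1), (1, 0)#}}"
    by (auto simp: Pstar_def Kstar_def add_is_1 add_mset_commute)
next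
  fix S assume "S \<in> {{#(0, 1), (1, 0)#} :: (nat \<times> nat) multiset}"
  with assms show "S \<in> Pstar N 2 (1, 1)"
    by (auto simp: Pstar_def Kstar_def)
qed

text \<open>A diagonal member of \<open>Kstar\<close> has first coordinate at least 1, and these
  coordinates add up to 2, so there are at most two members; \<open>2 \<le> l\<close> leaves out
  \<open>{#(2, 2)#}\<close>. The use is by contraposition: every other multiset has an off-diagonal
  member, whose entry vanishes in the limit.\<close>

lemma Pstar_22_diag:
  assumes "S \<in> Pstar N l (2, 2)" "2 \<le> l" "\<forall>x\<in>#S. fst x = snd x"
  shows "l = 2 \<and> S = {#(1, 1), (1, 1)#}"
proof -
  have pos: "1 \<le> fst x" if "x \<in># S" for x
  proof -
    have "x \<noteq> (0, 0)" "fst x = snd x"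
      using assms(1,3) that by (auto simp: Pstar_def Kstar_def)
    then show ?thesis by (cases x) auto
  qed
  have fst_sum: "fst (\<Sum>\<^sub># T) = (\<Sum>x\<in>#T. fst x)" for T :: "(nat \<times> nat) multiset"
    by (induction T) auto
  have "size S \<le> (\<Sum>x\<in>#S. fst x)"
    using pos by (induction S) (auto simp: Suc_le_eq add_less_le_mono trans_le_add1, fastforce)
  then have l: "l = 2"
    using assms(1,2) by (simp add: Pstar_def flip: fst_sum)
  then have "size S = 2" using assms(1) by (simp add: Pstar_def)
  then obtain a b where ab: "S = {#a, b#}"
    by (rule size_eq_2_imp_eq_pair_mset)
  obtain a1 a2 b1 b2 where "a = (a1, a2)" "b = (b1, b2)" by (metis surj_pair)
  with assms(1,3) pos[of a] pos[of b] ab have "a1 = a2" "b1 = b2" "1 \<le> a2" "1 \<le> b2" "a2 + b2 = 2"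
    by (auto simp: Pstar_def)
  then have "a = (1, 1)" "b = (1, 1)"
    using \<open>a = (a1, a2)\<close> \<open>b = (b1, b2)\<close> by auto
  with ab l show ?thesis by simp
qed

lemma prod_fact_count_eq_1:
  assumes "\<And>x. count S x \<le> 1"
  shows "(\<Prod>x\<in>K. fact (count S x)) = (1 :: complex)"
  using assms by (intro prod.neutral) (metis One_nat_def fact_0 fact_1 le_SucE le_zero_eq)

lemma f_diamond_00: "0 < N \<Longrightarrow> f_diamond f N h A $$ (0, 0) = f (A $$ (0, 0))"
  by (simp add: f_diamond_def)

lemma f_diamond_index:
  assumes "(i, j) \<in> Kstar N"
  shows "f_diamond f N h A $$ (i, j) = (\<Sum>l = 1..i + j. Dh h l f (A $$ (0, 0)) *
            (\<Sum>S \<in> Pstar N l (i, j).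
               1 / (\<Prod>mn \<in> Kstar N. fact (count S mn)) * (\<Prod>pq \<in># S. A $$ pq)))"
  using assms by (auto simp: f_diamond_def Kstar_def)

lemma Pstar_1_sum:
  assumes "ij \<in> Kstar N"
  shows "(\<Sum>S \<in> Pstar N 1 ij. 1 / (\<Prod>mn \<in> Kstar N. fact (count S mn)) * (\<Prod>pq \<in># S. A $$ pq))
    = (A $$ ij :: complex)"
  unfolding Pstar_1[OF assms] by (simp add: prod_fact_count_eq_1)

lemma f_diamond_01:
  assumes "2 \<le> N"
  shows "f_diamond f N h A $$ (0, 1) = Dh h 1 f (A $$ (0, 0)) * A $$ (0, 1)"
    and "f_diamond f N h A $$ (1, 0) = Dh h 1 f (A $$ (0, 0)) * A $$ (1, 0)"
proof -
  have "(0, 1) \<in> Kstar N" "(1, 0) \<in> Kstar N" using assms by (auto simp: Kstar_def)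
  then show "f_diamond f N h A $$ (0, 1) = Dh h 1 f (A $$ (0, 0)) * A $$ (0, 1)"
    and "f_diamond f N h A $$ (1, 0) = Dh h 1 f (A $$ (0, 0)) * A $$ (1, 0)"
    using Pstar_1_sum[of "(0, 1)" N A] Pstar_1_sum[of "(1, 0)" N A]
    by (simp_all add: f_diamond_index)
qed

text \<open>Orders 1 and 2 contribute one multiset each. Neither has a repeated member, so both
  factorial weights are 1.\<close>

lemma f_diamond_11:
  assumes "2 \<le> N"
  shows "f_diamond f N h A $$ (1, 1) = Dh h 1 f (A $$ (0, 0)) * A $$ (1, 1)
    + Dh h 2 f (A $$ (0, 0)) * (A $$ (0, 1) * A $$ (1, 0))"
proof -
  have K: "(1, 1) \<in> Kstar N" using assms by (auto simp: Kstar_def)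
  have fact_1: "(\<Prod>x\<in>Kstar N. fact (count {#(0, 1), (1, 0)#} x)) = (1 :: complex)"
    by (rule prod_fact_count_eq_1) auto
  have ivl: "{1..1 + 1} = {1, 2 :: nat}" by auto
  show ?thesis
    unfolding f_diamond_index[OF K] ivl
    using Pstar_1_sum[OF K, of A] fact_1
    by (simp add: Pstar_2_11[OF assms, unfolded One_nat_def] del: count_add_mset)
qed

lemma tendsto_prod_mset:
  fixes F :: "'b \<Rightarrow> 'a \<Rightarrow> 'c :: {real_normed_algebra, comm_ring_1}"
  assumes "\<And>x. x \<in># S \<Longrightarrow> ((\<lambda>t. F t x) \<longlongrightarrow> L x) \<F>"
  shows "((\<lambda>t. \<Prod>x\<in>#S. F t x) \<longlongrightarrow> (\<Prod>x\<in>#S. L x)) \<F>"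
  using assms by (induction S) (auto intro!: tendsto_intros)

text \<open>With the entry \<open>(0, 0)\<close> held at \<open>a\<close> the difference quotients
  are constants, so the image entry is a polynomial in the other entries and the limit is taken term
  by term. A multiset with an off-diagonal member contributes 0. The survivors are
  \<open>{#(2, 2)#}\<close> and \<open>{#(1, 1), (1, 1)#}\<close>, the latter with weight 1/2! from
  its repeated member.\<close>

lemma f_diamond_22_tendsto:
  assumes N: "3 \<le> N" and A00: "\<And>t. A t $$ (0, 0) = a"
    and lim: "\<And>i j. i < N \<Longrightarrow> j < N \<Longrightarrow> ((\<lambda>t. A t $$ (i, j)) \<longlongrightarrow> L (i, j)) \<F>"
    and offdiag: "\<And>i j. i \<noteq> j \<Longrightarrow> L (i, j) = 0"
  shows "((\<lambda>t. f_diamond f N h (A t) $$ (2, 2)) \<longlongrightarrow>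
    Dh h 1 f a * L (2, 2) + Dh h 2 f a * ((L (1, 1))\<^sup>2 / 2)) \<F>"
proof -
  define c :: "(nat \<times> nat) multiset \<Rightarrow> complex" where
    "c S = 1 / (\<Prod>mn \<in> Kstar N. fact (count S mn))" for S
  define G where "G l = (\<Sum>S \<in> Pstar N l (2, 2). c S * (\<Prod>pq \<in># S. L pq))" for l
  let ?D = "{#(1, 1), (1, 1)#} :: (nat \<times> nat) multiset"
  have K: "(2, 2) \<in> Kstar N" using N by (auto simp: Kstar_def)
  have "((\<lambda>t. A t $$ x) \<longlongrightarrow> L x) \<F>" if "x \<in># S" "S \<in> Pstar N l (2, 2)" for x S l
    using lim[of "fst x" "snd x"] that by (auto simp: Pstar_def Kstar_def)
  then have "((\<lambda>t. f_diamond f N h (A t) $$ (2, 2)) \<longlongrightarrow> (\<Sum>l = 1..2 + 2. Dh h l f a * G l)) \<F>"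
    unfolding f_diamond_index[OF K] A00 G_def c_def
    by (intro tendsto_intros tendsto_prod_mset) auto
  also have "(\<Sum>l = 1..2 + 2. Dh h l f a * G l) = (\<Sum>l\<in>{1, 2}. Dh h l f a * G l)"
  proof (rule sum.mono_neutral_right)
    have "G l = 0" if "3 \<le> l" for l
    proof -
      have "(\<Prod>pq \<in># S. L pq) = 0" if "S \<in> Pstar N l (2, 2)" for S
        using Pstar_22_diag[OF that] \<open>3 \<le> l\<close> offdiag by force
      then show ?thesis by (simp add: G_def)
    qed
    then show "\<forall>l\<in>{1..2 + 2} - {1, 2}. Dh h l f a * G l = 0" by auto
  qed auto
  also have "G 1 = L (2, 2)"
    unfolding G_def Pstar_1[OF K] c_def by (simp add: prod_fact_count_eq_1)
  moreover have "G 2 = (L (1, 1))\<^sup>2 / 2"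
  proof -
    have D: "?D \<in> Pstar N 2 (2, 2)" "(1, 1) \<in> Kstar N"
      using N by (auto simp: Pstar_def Kstar_def)
    have "(\<Prod>pq \<in># S. L pq) = 0" if "S \<in> Pstar N 2 (2, 2)" "S \<noteq> ?D" for S
      using Pstar_22_diag[OF that(1)] that(2) offdiag by force
    then have "G 2 = (\<Sum>S \<in> {?D}. c S * (\<Prod>pq \<in># S. L pq))"
      unfolding G_def using D by (intro sum.mono_neutral_right finite_Pstar) auto
    moreover have "c ?D = 1 / 2"
    proof -
      have "(\<Prod>mn \<in> Kstar N. fact (count ?D mn)) = (fact (count ?D (1, 1)) :: complex)"
      proof -
        have "(\<Prod>mn \<in> Kstar N. fact (count ?D mn)) = (\<Prod>mn \<in> {(1, 1)}. fact (count ?D mn) :: complex)"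
          using D by (intro prod.mono_neutral_right) (auto simp: Kstar_def)
        then show ?thesis by simp
      qed
      then show ?thesis by (simp add: c_def numeral_2_eq_2[symmetric])
    qed
    ultimately show ?thesis by (simp add: power2_eq_square)
  qed
  ultimately show ?thesis by simp
qed

section \<open>Convexity, monotonicity and continuity of real functions from difference
  inequalities\<close>

lemma convex_on_if_midpoint_convex:
  fixes g :: "real \<Rightarrow> real"
  assumes "convex S" "continuous_on S g"
    and mid: "\<And>x y. x \<in> S \<Longrightarrow> y \<in> S \<Longrightarrow> 2 * g ((x + y) / 2) \<le> g x + g y"
  shows "convex_on S g"
proof (rule convex_onI)
  fix t x y :: real
  assume t: "0 < t" "t < 1" and xy: "x \<in> S" "y \<in> S"
  define p where "p s = (1 - s) * x + s * y" for s
  \<comment> \<open>The excess of \<open>g\<close> over its chord: subtracting an affine function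
    keeps midpoint convexity, and the excess is 0 at both ends. It suffices that its maximum is at
    most 0.\<close>
  define \<phi> where "\<phi> s = g (p s) - ((1 - s) * g x + s * g y)" for s
  have pS: "p s \<in> S" if "s \<in> {0..1}" for s
    using convexD_alt[OF assms(1) xy, of s] that by (simp add: p_def)
  have "continuous_on {0..1} (\<lambda>s. g (p s))"
    by (rule continuous_on_compose2[OF assms(2)])
      (auto simp: p_def[abs_def] pS[unfolded p_def] intro!: continuous_intros)
  then have "continuous_on {0..1} \<phi>"
    unfolding \<phi>_def by (intro continuous_intros)
  then obtain m where m: "m \<in> {0..1}" "\<And>s. s \<in> {0..1} \<Longrightarrow> \<phi> s \<le> \<phi> m"
    using continuous_attains_sup[of "{0..1::real}" \<phi>] by force
  have \<phi>_mid: "2 * \<phi> ((r + s) / 2) \<le> \<phi> r + \<phi> s" if "r \<in> {0..1}" "s \<in> {0..1}" for r s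
  proof -
    have "p ((r + s) / 2) = (p r + p s) / 2" by (simp add: p_def field_simps)
    then have "2 * g (p ((r + s) / 2)) \<le> g (p r) + g (p s)"
      using mid[OF pS[OF that(1)] pS[OF that(2)]] by (simp only:)
    then show ?thesis by (simp add: \<phi>_def algebra_simps add_divide_distrib)
  qed
  have ends: "\<phi> 0 = 0" "\<phi> 1 = 0" by (simp_all add: \<phi>_def p_def)
  \<comment> \<open>Reflect the nearer endpoint, where \<open>\<phi>\<close> vanishes, in the maximum point \<open>m\<close>.\<close>
  have "\<phi> m \<le> 0"
  proof (cases "m \<le> 1 / 2")
    case True
    then show ?thesis using \<phi>_mid[of 0 "2 * m"] m(1) m(2)[of "2 * m"] ends by simp
  next
    case False
    then show ?thesis using \<phi>_mid[of "2 * m - 1" 1] m(1) m(2)[of "2 * m - 1"] ends by simp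
  qed
  then have "\<phi> t \<le> 0" using m(2)[of t] t by simp
  then show "g ((1 - t) *\<^sub>R x + t *\<^sub>R y) \<le> (1 - t) * g x + t * g y"
    by (simp add: \<phi>_def p_def)
qed (rule assms(1))

text \<open>The limit is the infimum over \<open>{0<..<\<delta>}\<close>. This supplies both
  one-sided limits of a monotone \<open>g\<close> at \<open>x\<close>, through
  \<open>g (x + h)\<close> and \<open>- g (x - h)\<close>.\<close>

lemma mono_on_tendsto_at_right_0:
  fixes \<phi> :: "real \<Rightarrow> real"
  assumes "0 < \<delta>" and mono: "\<And>s t. 0 < s \<Longrightarrow> s \<le> t \<Longrightarrow> t < \<delta> \<Longrightarrow> \<phi> s \<le> \<phi> t"
    and bound: "\<And>t. 0 < t \<Longrightarrow> t < \<delta> \<Longrightarrow> B \<le> \<phi> t"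
  obtains R where "B \<le> R" "(\<phi> \<longlongrightarrow> R) (at_right 0)"
proof
  let ?R = "Inf (\<phi> ` {0<..<\<delta>})"
  have ne: "\<phi> ` {0<..<\<delta>} \<noteq> {}" using \<open>0 < \<delta>\<close> by simp
  have bdd: "bdd_below (\<phi> ` {0<..<\<delta>})" using bound by (intro bdd_belowI) auto
  show "B \<le> ?R" using ne bound by (intro cInf_greatest) auto
  have near: "\<forall>\<^sub>F t in at_right 0. 0 < t \<and> t < s" if "0 < s" for s :: real
    using eventually_at_right_real[OF that] by simp
  show "(\<phi> \<longlongrightarrow> ?R) (at_right 0)"
  proof (rule decreasing_tendsto)
    show "\<forall>\<^sub>F t in at_right 0. ?R \<le> \<phi> t"
      using near[OF \<open>0 < \<delta>\<close>] by eventually_elim (auto intro: cInf_lower[OF _ bdd])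
  next
    fix y assume "?R < y"
    then obtain s where s: "0 < s" "s < \<delta>" "\<phi> s < y" using cInf_lessD[OF ne, of y] by force
    show "\<forall>\<^sub>F t in at_right 0. \<phi> t < y"
      using near[OF s(1)]
    proof eventually_elim
      case (elim t)
      then show ?case using mono[of t s] s by simp
    qed
  qed
qed

text \<open>A step of length \<open>h\<close> requires \<open>a + K * h\<close> to lie in
  \<open>I\<close>, which may fail for long steps near the upper end. The way from \<open>x\<close>
  to \<open>y\<close> is therefore cut into equal steps so short that this point stays within the
  room that openness leaves above \<open>y\<close>.\<close>

lemma mono_on_if_small_steps:
  fixes g :: "real \<Rightarrow> real"
  assumes "open I" and pos: "\<And>x. x \<in> I \<Longrightarrow> 0 < x"
    and down: "\<And>x y. y \<in> I \<Longrightarrow> 0 < x \<Longrightarrow> x \<le> y \<Longrightarrow> x \<in> I"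
    and step: "\<And>a h. 0 < a \<Longrightarrow> 0 < h \<Longrightarrow> a + K * h \<in> I \<Longrightarrow> g a \<le> g (a + h)"
    and "0 < K"
  shows "mono_on I g"
proof (rule mono_onI)
  fix x y assume xy: "x \<in> I" "y \<in> I" "x \<le> y"
  show "g x \<le> g y"
  proof (cases "x = y")
    case False
    obtain \<epsilon> where \<epsilon>: "0 < \<epsilon>" "\<And>z. dist z y < \<epsilon> \<Longrightarrow> z \<in> I"
      using \<open>open I\<close> \<open>y \<in> I\<close> unfolding open_dist by blast
    \<comment> \<open>Chosen so that the step \<open>h = (y - x) / n\<close> satisfies
      \<open>K * h < \<epsilon> / 2\<close>.\<close>
    obtain n :: nat where n: "K * (y - x) / (\<epsilon> / 2) < n" using reals_Archimedean2 by blast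
    moreover have "0 < K * (y - x) / (\<epsilon> / 2)"
      using False xy \<epsilon> \<open>0 < K\<close> by simp
    ultimately have "0 < n" by (metis less_trans of_nat_0_less_iff)
    define h where "h = (y - x) / n"
    have h: "0 < h" "real n * h = y - x" "K * h < \<epsilon> / 2"
      using False xy \<open>0 < n\<close> n \<epsilon> by (simp_all add: h_def field_simps)
    have "g x \<le> g (x + real k * h)" if "k \<le> n" for k
      using that
    proof (induction k)
      case (Suc k)
      have "real k * h \<le> real n * h"
        using Suc.prems h by (intro mult_right_mono) auto
      then have le: "x + real k * h + K * h \<le> y + \<epsilon> / 2" using h by simp
      have pos': "0 < x + real k * h" using pos[OF xy(1)] h by (simp add: add_pos_nonneg)
      have "y + \<epsilon> / 2 \<in> I" using \<epsilon>(1) by (intro \<epsilon>(2)) (auto simp: dist_real_def)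
      moreover have "0 < x + real k * h + K * h" using pos' h \<open>0 < K\<close> by (simp add: add_pos_pos)
      ultimately have "x + real k * h + K * h \<in> I" using le by (rule down)
      then have "g (x + real k * h) \<le> g (x + real k * h + h)"
        by (rule step[OF pos' h(1)])
      with Suc show ?case by (simp add: algebra_simps)
    qed simp
    from this[of n] h show ?thesis by simp
  qed simp
qed

text \<open>Monotonicity gives one-sided limits \<open>L \<le> g x \<le> R\<close>. The inequality
  at \<open>a = x\<close> closes the gap on the right; then, with \<open>R = g x\<close> known, the
  inequality at \<open>a = x - h\<close> closes the one on the left.\<close>

lemma continuous_on_if_difference_ineq:
  fixes g :: "real \<Rightarrow> real"
  assumes "open I" and pos: "\<And>x. x \<in> I \<Longrightarrow> 0 < x"
    and down: "\<And>x y. y \<in> I \<Longrightarrow> 0 < x \<Longrightarrow> x \<le> y \<Longrightarrow> x \<in> I"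
    and mono: "mono_on I g" and nonneg: "\<And>x. x \<in> I \<Longrightarrow> 0 \<le> g x"
    and ineq: "\<And>a h. 0 < a \<Longrightarrow> 0 < h \<Longrightarrow> a + K * h \<in> I \<Longrightarrow>
      (g (a + h) - g a)\<^sup>2 \<le> g a * (h * (g (a + h) - g a) / a + (g (a + 2 * h) - 2 * g (a + h) + g a))"
    and "2 \<le> K"
  shows "continuous_on I g"
proof -
  have "isCont g x" if x: "x \<in> I" for x
  proof -
    have x0: "0 < x" by (rule pos[OF x])
    obtain \<epsilon> where \<epsilon>: "0 < \<epsilon>" "\<And>z. dist z x < \<epsilon> \<Longrightarrow> z \<in> I"
      using \<open>open I\<close> x unfolding open_dist by blast
    \<comment> \<open>The bound \<open>x\<close> keeps \<open>x - h\<close> positive; the other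
      bound keeps \<open>x + h\<close> and \<open>x + K * h\<close> within \<open>\<epsilon>\<close>
      of \<open>x\<close>.\<close>
    define \<delta> where "\<delta> = min x (\<epsilon> / (K + 1))"
    have \<delta>: "K * h < \<epsilon>" "h < \<epsilon>" if "h < \<delta>" "0 < h" for h
    proof -
      have "(K + 1) * h < \<epsilon>"
        using that \<open>2 \<le> K\<close> by (simp add: \<delta>_def pos_less_divide_eq mult.commute)
      then have "K * h + h < \<epsilon>" by (simp add: algebra_simps)
      moreover have "0 < K * h" using that \<open>2 \<le> K\<close> by simp
      ultimately show "K * h < \<epsilon>" "h < \<epsilon>" using that by auto
    qed
    have \<delta>0: "0 < \<delta>" using \<epsilon> x0 \<open>2 \<le> K\<close> by (simp add: \<delta>_def)
    have near: "\<forall>\<^sub>F t in at_right 0. 0 < t \<and> t < \<delta>"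
      using eventually_at_right_real[OF \<delta>0] by simp
    have up: "x + K * h \<in> I" "x + h \<in> I" "0 < x - h" "x - h \<in> I" if "0 < h" "h < \<delta>" for h
    proof -
      show K: "x + K * h \<in> I"
        using \<delta>[OF that(2,1)] that \<epsilon> \<open>2 \<le> K\<close> by (intro \<epsilon>(2)) (auto simp: dist_real_def)
      show "x + h \<in> I"
        using \<delta>[OF that(2,1)] that \<epsilon> \<open>2 \<le> K\<close> by (intro \<epsilon>(2)) (auto simp: dist_real_def)
      show "0 < x - h" using that by (simp add: \<delta>_def)
      then show "x - h \<in> I" using that by (intro down[OF x]) auto
    qed
    obtain R where R: "g x \<le> R" "((\<lambda>h. g (x + h)) \<longlongrightarrow> R) (at_right 0)"
    proof (rule mono_on_tendsto_at_right_0[OF \<delta>0])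
      fix s t :: real assume "0 < s" "s \<le> t" "t < \<delta>"
      then show "g (x + s) \<le> g (x + t)" using up by (intro mono_onD[OF mono]) auto
    next
      fix t :: real assume "0 < t" "t < \<delta>"
      then show "g x \<le> g (x + t)" using up x by (intro mono_onD[OF mono]) auto
    qed
    obtain L' where L': "- g x \<le> L'" "((\<lambda>h. - g (x - h)) \<longlongrightarrow> L') (at_right 0)"
    proof (rule mono_on_tendsto_at_right_0[OF \<delta>0])
      fix s t :: real assume "0 < s" "s \<le> t" "t < \<delta>"
      then show "- g (x - s) \<le> - g (x - t)"
        using up[of s] up[of t] by (simp add: mono_onD[OF mono])
    next
      fix t :: real assume "0 < t" "t < \<delta>"
      then show "- g x \<le> - g (x - t)" using up x by (simp add: mono_onD[OF mono])
    qed
    define L where "L = - L'"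
    have L: "L \<le> g x" "((\<lambda>h. g (x - h)) \<longlongrightarrow> L) (at_right 0)"
      using L' tendsto_minus[OF L'(2)] by (simp_all add: L_def)
    have "0 \<le> L"
      using near by (intro tendsto_lowerbound[OF L(2)]) (auto elim!: eventually_mono intro: nonneg up)
    have double: "filterlim (\<lambda>h::real. 2 * h) (at_right 0) (at_right 0)"
      by (auto simp: filterlim_at intro!: tendsto_eq_intros eventually_mono[OF eventually_at_right_less[of 0]])
    have R2: "((\<lambda>h. g (x + 2 * h)) \<longlongrightarrow> R) (at_right 0)"
      using filterlim_compose[OF R(2) double] .

    \<comment> \<open>The right side is left in the shape of the termwise limit. Both
      \<open>g (x + h)\<close> and \<open>g (x + 2 * h)\<close> tend to \<open>R\<close>, so the
      second difference tends to \<open>g x - R\<close>.\<close>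
    have "(R - g x)\<^sup>2 \<le> g x * (0 * (R - g x) / x + (R - 2 * R + g x))"
    proof (rule tendsto_le[OF _ _ _])
      show "((\<lambda>h. g x * (h * (g (x + h) - g x) / x + (g (x + 2 * h) - 2 * g (x + h) + g x)))
        \<longlongrightarrow> g x * (0 * (R - g x) / x + (R - 2 * R + g x))) (at_right 0)"
        using x0 by (intro tendsto_intros R R2) auto
      show "((\<lambda>h. (g (x + h) - g x)\<^sup>2) \<longlongrightarrow> (R - g x)\<^sup>2) (at_right 0)"
        by (intro tendsto_intros R)
      show "\<forall>\<^sub>F h in at_right 0. (g (x + h) - g x)\<^sup>2
          \<le> g x * (h * (g (x + h) - g x) / x + (g (x + 2 * h) - 2 * g (x + h) + g x))"
        using near by eventually_elim (use ineq[OF x0] up in auto)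
    qed simp
    then have "(R - g x)\<^sup>2 \<le> - (g x * (R - g x))" by (simp add: algebra_simps)
    also have "\<dots> \<le> 0" using R(1) nonneg[OF x] by simp
    finally have "R = g x" by simp

    \<comment> \<open>Now the sample points are \<open>x - h\<close>, \<open>x\<close> and
      \<open>x + h\<close>. As \<open>R = g x\<close>, the second difference tends to
      \<open>L - g x\<close>, and \<open>0 \<le> L\<close> fixes the sign.\<close>
    have "(g x - L)\<^sup>2 \<le> L * (0 * (g x - L) / (x - 0) + (R - 2 * g x + L))"
    proof (rule tendsto_le[OF _ _ _])
      show "((\<lambda>h. g (x - h) * (h * (g x - g (x - h)) / (x - h) + (g (x + h) - 2 * g x + g (x - h))))
        \<longlongrightarrow> L * (0 * (g x - L) / (x - 0) + (R - 2 * g x + L))) (at_right 0)"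
        using x0 by (intro tendsto_intros R L) auto
      show "((\<lambda>h. (g x - g (x - h))\<^sup>2) \<longlongrightarrow> (g x - L)\<^sup>2) (at_right 0)"
        by (intro tendsto_intros L)
      show "\<forall>\<^sub>F h in at_right 0. (g x - g (x - h))\<^sup>2
          \<le> g (x - h) * (h * (g x - g (x - h)) / (x - h) + (g (x + h) - 2 * g x + g (x - h)))"
        using near
      proof eventually_elim
        case (elim h)
        have "x - h + K * h \<in> I"
          using elim up[of h] \<open>2 \<le> K\<close> by (intro down[OF up(1)[of h]]) (auto intro: add_pos_pos)
        from ineq[OF _ _ this] show ?case using elim up[of h] by (simp add: algebra_simps)
      qed
    qed simp
    then have "(g x - L)\<^sup>2 \<le> - (L * (g x - L))" by (simp add: \<open>R = g x\<close> algebra_simps)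
    also have "\<dots> \<le> 0" using L(1) \<open>0 \<le> L\<close> by simp
    finally have "L = g x" by simp
    have "(g \<longlongrightarrow> g x) (at_left x)"
      unfolding filterlim_at_left_to_right filterlim_at_right_to_0[of _ _ "- x"]
      using L(2) \<open>L = g x\<close> by simp
    moreover have "(g \<longlongrightarrow> g x) (at_right x)"
      unfolding filterlim_at_right_to_0[of _ _ x]
      using R(2) \<open>R = g x\<close> by (simp add: add.commute)
    ultimately show "isCont g x"
      unfolding isCont_def by (rule filterlim_split_at)
  qed
  then show ?thesis by (simp add: continuous_at_imp_continuous_on)
qed

section \<open>Inequalities for \<open>f\<close> from its action on the test matrices\<close>

theorem theorem3:
  fixes \<rho> :: ereal and I :: "real set" and \<Omega> :: "complex set"
    and f :: "complex \<Rightarrow> complex" and N :: nat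
  assumes "0 < \<rho>"
    and "I = {x. 0 < x \<and> ereal x < \<rho>}"
    and "\<Omega> \<inter> complex_of_real ` {0<..} = complex_of_real ` I"
    and "N \<ge> 2"
    and "\<And>A h. \<lbrakk>A \<in> psd_mats N \<Omega>; 0 < h;
           {Re (A $$ (0, 0)) <..< Re (A $$ (0, 0)) + 2 * (real N - 1) * h} \<subseteq> I;
           f_diamond_defined \<Omega> N h A\<rbrakk>
         \<Longrightarrow> f_diamond f N h A \<in> psd_mats N UNIV"
  shows "(\<forall>x \<in> I. f (complex_of_real x) \<in> \<real>) \<and>
         (\<forall>x \<in> I. 0 \<le> Re (f (complex_of_real x))) \<and>
         mono_on I (\<lambda>x. Re (f (complex_of_real x))) \<and>
         continuous_on I (\<lambda>x. Re (f (complex_of_real x))) \<and>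
         (N \<ge> 3 \<and> \<rho> = \<infinity> \<longrightarrow> convex_on I (\<lambda>x. Re (f (complex_of_real x))))"
proof -
  define g where "g x = Re (f (complex_of_real x))" for x
  define K where "K = 2 * (real N - 1)"
  have K: "2 \<le> K" using \<open>N \<ge> 2\<close> by (simp add: K_def)
  have I_pos: "0 < x" if "x \<in> I" for x using that assms(2) by simp
  have I_down: "x \<in> I" if "y \<in> I" "0 < x" "x \<le> y" for x y
    using that assms(2) by (auto intro: le_less_trans[of "ereal x" "ereal y"])
  have I_cases: "I = {0<..} \<or> (\<exists>r. I = {0<..<r})"
    using assms(1,2) by (cases \<rho>) auto
  then have "open I" by auto
  have \<Omega>: "complex_of_real x \<in> \<Omega>" if "x \<in> I" for x
    using that assms(3) by blast

  \<comment> \<open>Since \<open>I\<close> contains all positive reals below any of its points,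
    having the last argument \<open>e + d 0 + K * h\<close> in \<open>I\<close> secures both the
    interval condition and \<open>f_diamond_defined\<close>.\<close>
  have psd: "pos_semidef N (f_diamond f N h (const_plus_diag N e d))"
    if "e \<in> I" "0 < h" "e + d 0 + K * h \<in> I" and d: "\<And>i. i < N \<Longrightarrow> 0 \<le> d i \<and> e + d i \<in> I" for e h d
  proof -
    let ?A = "const_plus_diag N e d"
    have A00: "?A $$ (0, 0) = complex_of_real (e + d 0)"
      using \<open>N \<ge> 2\<close> by (simp add: const_plus_diag_index)
    have d0: "0 < e + d 0" using d[of 0] \<open>N \<ge> 2\<close> I_pos by simp
    have "?A \<in> psd_mats N \<Omega>"
      using that I_pos[OF that(1)] \<Omega>
      by (auto simp: psd_mats_def const_plus_diag_index simp del: of_real_add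
          intro!: pos_semidef_const_plus_diag)
    moreover have "{Re (?A $$ (0, 0)) <..< Re (?A $$ (0, 0)) + 2 * (real N - 1) * h} \<subseteq> I"
      unfolding A00 K_def[symmetric] Re_complex_of_real
    proof
      fix x assume "x \<in> {e + d 0<..<e + d 0 + K * h}"
      then show "x \<in> I" using d0 by (intro I_down[OF that(3)]) auto
    qed
    moreover have "f_diamond_defined \<Omega> N h ?A"
      unfolding f_diamond_defined_def A00
    proof
      fix k assume "k \<in> {0..2 * N - 2}"
      then have "real k \<le> K" using \<open>N \<ge> 2\<close> by (auto simp: K_def)
      then have "real k * h \<le> K * h" using \<open>0 < h\<close> by simp
      then have "e + d 0 + real k * h \<in> I"
        using d0 \<open>0 < h\<close> by (intro I_down[OF that(3)]) (auto intro: add_pos_nonneg)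
      then show "complex_of_real (e + d 0) + of_nat k * complex_of_real h \<in> \<Omega>"
        using \<Omega>[of "e + d 0 + real k * h"] by simp
    qed
    ultimately show ?thesis
      using assms(5)[of ?A h] \<open>0 < h\<close> by (auto simp: psd_mats_def)
  qed

  have room: "\<exists>h>0. x + K * h \<in> I" if "x \<in> I" for x
  proof -
    have "\<exists>\<epsilon>>0. \<forall>z. dist z x < \<epsilon> \<longrightarrow> z \<in> I"
      using \<open>open I\<close> that by (simp add: open_dist)
    then obtain \<epsilon> where \<epsilon>: "0 < \<epsilon>" "\<And>z. dist z x < \<epsilon> \<Longrightarrow> z \<in> I"
      by metis
    define h where "h = \<epsilon> / (2 * K)"
    have h: "0 < h" "K * h = \<epsilon> / 2" using \<epsilon>(1) K by (simp_all add: h_def)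
    have "x + K * h \<in> I"
      unfolding h(2) using \<epsilon>(1) by (intro \<epsilon>(2)) (simp add: dist_real_def)
    with h(1) show ?thesis by blast
  qed
  \<comment> \<open>For any admissible \<open>h\<close> the image entry \<open>(0, 0)\<close> is the
    value of \<open>f\<close> at \<open>x\<close>; in the complex order its nonnegativity also makes
    it real.\<close>
  have f_nonneg: "0 \<le> f (complex_of_real x)" if x: "x \<in> I" for x
  proof -
    obtain h where h: "0 < h" "x + K * h \<in> I" using room[OF x] by blast
    have "pos_semidef N (f_diamond f N h (const_plus_diag N x (\<lambda>_. 0)))"
      using h x by (intro psd) auto
    from pos_semidef_diag_nonneg[OF this, of 0] show ?thesis
      using \<open>N \<ge> 2\<close> by (simp add: f_diamond_00 const_plus_diag_index)
  qed
  have fg: "f (complex_of_real x) = complex_of_real (g x)" and g_nonneg: "0 \<le> g x" if "x \<in> I" for x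
    using f_nonneg[OF that] by (auto simp: less_eq_complex_def g_def complex_eq_iff)

  define D1 where "D1 a h = (g (a + h) - g a) / h" for a h
  define D2 where "D2 a h = (g (a + 2 * h) - 2 * g (a + h) + g a) / h\<^sup>2" for a h
  have inI: "a \<in> I" "a + h \<in> I" "a + 2 * h \<in> I" if "0 < a" "0 < h" "a + K * h \<in> I" for a h
  proof -
    have "2 * h \<le> K * h" using K that by simp
    then show "a \<in> I" "a + h \<in> I" "a + 2 * h \<in> I"
      using that by (auto intro!: I_down[OF that(3)])
  qed
  have Dh1: "Dh h 1 f (complex_of_real a) = complex_of_real (D1 a h)"
    and Dh2: "Dh h 2 f (complex_of_real a) = complex_of_real (D2 a h)"
    if "0 < a" "0 < h" "a + K * h \<in> I" for a h
    using fg[OF inI(1)[OF that]] fg[OF inI(2)[OF that]] fg[OF inI(3)[OF that]]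
    by (auto simp: Dh_def D1_def D2_def numeral_2_eq_2 divide_inverse algebra_simps)

  have D1_nonneg: "0 \<le> D1 a h" if a: "0 < a" "0 < h" "a + K * h \<in> I" for a h
  proof -
    have "0 \<le> D1 a h + D2 a h * t" if t: "0 < t" "t \<le> a" for t
    proof -
      \<comment> \<open>This has \<open>a\<close> at \<open>(0, 0)\<close> and \<open>t\<close>
        elsewhere; the diagonal part is nonnegative because \<open>t \<le> a\<close>.\<close>
      let ?A = "const_plus_diag N t (\<lambda>i. if i = 0 then a - t else 0)"
      have "t \<in> I" using inI(1)[OF a] t by (rule I_down)
      then have "pos_semidef N (f_diamond f N h ?A)"
        using a t inI(1)[OF a] by (intro psd) auto
      from pos_semidef_diag_nonneg[OF this, of 1]
      have "0 \<le> complex_of_real (D1 a h * t + D2 a h * (t * t))"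
        using \<open>N \<ge> 2\<close> Dh1[OF a] Dh2[OF a]
        by (simp add: f_diamond_11[unfolded One_nat_def] const_plus_diag_index)
      \<comment> \<open>The factor \<open>t\<close> has to be removed before the limit, as the entry
        itself tends to 0.\<close>
      then have "0 \<le> t * (D1 a h + D2 a h * t)"
        by (simp add: less_eq_complex_def algebra_simps)
      then show ?thesis using t by (simp add: zero_le_mult_iff)
    qed
    then have "\<forall>\<^sub>F t in at_right 0. 0 \<le> D1 a h + D2 a h * t"
      using eventually_at_right_real[OF a(1)] by (auto elim: eventually_mono)
    moreover have "((\<lambda>t. D1 a h + D2 a h * t) \<longlongrightarrow> D1 a h) (at_right 0)"
      by (auto intro!: tendsto_eq_intros)
    ultimately show ?thesis by (intro tendsto_lowerbound) auto
  qed
  have mono: "mono_on I g"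
  proof (rule mono_on_if_small_steps[OF \<open>open I\<close> I_pos I_down])
    fix a h :: real assume "0 < a" "0 < h" "a + K * h \<in> I"
    from D1_nonneg[OF this] \<open>0 < h\<close> show "g a \<le> g (a + h)"
      by (simp add: D1_def zero_le_divide_iff)
  qed (use K in auto)

  have cont: "continuous_on I g"
  proof (rule continuous_on_if_difference_ineq[OF \<open>open I\<close> I_pos I_down mono g_nonneg _ K])
    fix a h :: real assume a: "0 < a" "0 < h" "a + K * h \<in> I"
    let ?B = "f_diamond f N h (const_plus_diag N a (\<lambda>_. 0))"
    have "pos_semidef N ?B" using a inI(1)[OF a] by (intro psd) auto
    then have "(D1 a h * a)\<^sup>2 \<le> g a * (D1 a h * a + D2 a h * (a * a))"
      using \<open>N \<ge> 2\<close> Dh1[OF a] Dh2[OF a] fg[OF inI(1)[OF a]]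
      by (intro pos_semidef_real_minor[of N ?B 0 1])
        (auto simp: f_diamond_00 f_diamond_01[unfolded One_nat_def] f_diamond_11[unfolded One_nat_def]
          const_plus_diag_index)
    \<comment> \<open>The factor turns the left side into the squared first difference and clears
      the powers of \<open>h\<close> from the denominators.\<close>
    then have "(D1 a h * a)\<^sup>2 * (h / a)\<^sup>2 \<le> g a * (D1 a h * a + D2 a h * (a * a)) * (h / a)\<^sup>2"
      by (rule mult_right_mono) simp
    moreover have "(D1 a h * a)\<^sup>2 * (h / a)\<^sup>2 = (g (a + h) - g a)\<^sup>2"
      using a by (simp add: D1_def power_mult_distrib power_divide)
    moreover have "(D1 a h * a + D2 a h * (a * a)) * (h / a)\<^sup>2
        = h * (g (a + h) - g a) / a + (g (a + 2 * h) - 2 * g (a + h) + g a)"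
      using a by (simp add: D1_def D2_def field_simps power2_eq_square)
    ultimately show "(g (a + h) - g a)\<^sup>2
        \<le> g a * (h * (g (a + h) - g a) / a + (g (a + 2 * h) - 2 * g (a + h) + g a))"
      by (simp add: mult.assoc)
  qed

  have convex: "convex_on I g" if N: "N \<ge> 3" and "\<rho> = \<infinity>"
  proof -
    have I: "I = {0<..}" using assms(2) \<open>\<rho> = \<infinity>\<close> by auto
    have D2_nonneg: "0 \<le> D2 a h" if a: "0 < a" "0 < h" for a h
    proof -
      have aI: "a + K * h \<in> I" using a K by (simp add: I add_pos_pos)
      have diag: "0 \<le> D1 a h * T + D2 a h * (T\<^sup>2 / 2)" if "0 < T" for T
      proof -
        \<comment> \<open>The diagonal is \<open>a, T, T, ...\<close> for every \<open>t\<close>,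
          and only the off-diagonal entries \<open>t\<close> move. Positivity holds once
          \<open>t\<close> is below \<open>min a T\<close>, and \<open>I = {0<..}\<close> admits
          every \<open>T > 0\<close>.\<close>
        define A where "A t = const_plus_diag N t (\<lambda>i. (if i = 0 then a else T) - t)" for t
        let ?L = "\<lambda>(i :: nat, j). complex_of_real (if i = j then if i = 0 then a else T else 0)"
        have A00: "A t $$ (0, 0) = complex_of_real a" for t
          using \<open>N \<ge> 3\<close> by (simp add: A_def const_plus_diag_index)
        have "((\<lambda>t. A t $$ (i, j)) \<longlongrightarrow> ?L (i, j)) (at_right 0)" if "i < N" "j < N" for i j
          using that by (auto simp: A_def const_plus_diag_index intro!: tendsto_eq_intros)
        from f_diamond_22_tendsto[where A = A and L = ?L and h = h and f = f, OF N A00 this]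
        have "((\<lambda>t. f_diamond f N h (A t) $$ (2, 2))
            \<longlongrightarrow> complex_of_real (D1 a h * T + D2 a h * (T\<^sup>2 / 2))) (at_right 0)"
          using Dh1[OF a aI] Dh2[OF a aI] by simp
        then have "((\<lambda>t. Re (f_diamond f N h (A t) $$ (2, 2)))
            \<longlongrightarrow> D1 a h * T + D2 a h * (T\<^sup>2 / 2)) (at_right 0)"
          using tendsto_Re by fastforce
        moreover have "\<forall>\<^sub>F t in at_right 0. 0 \<le> Re (f_diamond f N h (A t) $$ (2, 2))"
          using eventually_at_right_real[of 0 "min a T"]
        proof (rule eventually_mono)
          fix t assume t: "t \<in> {0<..<min a T}"
          then have "pos_semidef N (f_diamond f N h (A t))"
            unfolding A_def using a aI \<open>0 < T\<close> by (intro psd) (auto simp: I)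
          then have "0 \<le> f_diamond f N h (A t) $$ (2, 2)"
            using N by (intro pos_semidef_diag_nonneg) auto
          then show "0 \<le> Re (f_diamond f N h (A t) $$ (2, 2))"
            by (simp add: less_eq_complex_def)
        qed (use a \<open>0 < T\<close> in auto)
        ultimately show ?thesis by (intro tendsto_lowerbound) auto
      qed
      show ?thesis
      proof (rule ccontr)
        assume "\<not> 0 \<le> D2 a h"
        \<comment> \<open>Solves \<open>D1 a h + D2 a h * T / 2 = - 1\<close>; it is positive
          because \<open>D1 a h\<close> is nonnegative.\<close>
        define T where "T = 2 * (D1 a h + 1) / (- D2 a h)"
        have "0 < T"
          using \<open>\<not> 0 \<le> D2 a h\<close> D1_nonneg[OF a aI] by (simp add: T_def divide_pos_neg)
        have "D1 a h * T + D2 a h * (T\<^sup>2 / 2) = T * (D1 a h + D2 a h * T / 2)"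
          by (simp add: power2_eq_square algebra_simps)
        also have "D1 a h + D2 a h * T / 2 = - 1"
          using \<open>\<not> 0 \<le> D2 a h\<close> by (simp add: T_def field_simps)
        finally show False using diag[OF \<open>0 < T\<close>] \<open>0 < T\<close> by simp
      qed
    qed
    have mid: "2 * g ((x + y) / 2) \<le> g x + g y" if "0 < x" "x < y" for x y
    proof -
      \<comment> \<open>With this step the three sample points are \<open>x\<close>, the midpoint
        and \<open>y\<close>.\<close>
      have "0 \<le> D2 x ((y - x) / 2)" using that by (intro D2_nonneg) auto
      moreover have "x + (y - x) / 2 = (x + y) / 2" "x + 2 * ((y - x) / 2) = y"
        by (simp_all add: field_simps)
      ultimately show ?thesis using that
        unfolding D2_def by (simp only: zero_le_divide_iff) simp
    qed
    show ?thesis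
    proof (rule convex_on_if_midpoint_convex[OF _ cont])
      show "convex I" by (simp add: I)
      fix x y assume "x \<in> I" "y \<in> I"
      then show "2 * g ((x + y) / 2) \<le> g x + g y"
        using mid[of x y] mid[of y x] I_pos by (cases x y rule: linorder_cases) (auto simp: add.commute)
    qed
  qed
  have "f (complex_of_real x) \<in> \<real>" if "x \<in> I" for x using fg[OF that] by simp
  with g_nonneg mono cont convex show ?thesis
    unfolding g_def by blast
qed

end
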